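(* Let $\phi\in\mathcal{S}(\mathbb{R})\setminus\{0\}$ and let $(\lambda_1,\beta_1),(\lambda_2,\beta_2),(\lambda_3,\beta_3)$ be three distinct points of $(0,\infty)\times\mathbb{R}$. Then the three point finite wavelet system $\{\phi(\lambda_kx-\beta_k)\}_{k=1}^{3}$ is linearly independent.
   Context: $\mathcal{S}(\mathbb{R})$ is the space of complex-valued Schwartz functions on $\mathbb{R}$. Linear independence is over $\mathbb{C}$: if $\sum_{k=1}^3c_k\phi(\lambda_kx-\beta_k)=0$ for almost every $x\in\mathbb{R}$, with $c_k\in\mathbb{C}$, then $c_1=c_2=c_3=0$. *)

theory Defs
  imports "HOL-Analysis.Analysis"
begin

definition nth_vderiv :: "nat \<Rightarrow> (real \<Rightarrow> complex) \<Rightarrow> real \<Rightarrow> complex" where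
  "nth_vderiv n f = ((\<lambda>g x. vector_derivative g (at x)) ^^ n) f"

text \<open>The differentiability clause is needed because \<^const>\<open>vector_derivative\<close> is total: at a
  point where the function is not differentiable its value is an arbitrary vector.\<close>

definition schwartz_space :: "(real \<Rightarrow> complex) set" where
  "schwartz_space = {f.
     (\<forall>n x. nth_vderiv n f differentiable (at x)) \<and>
     (\<forall>m n. bounded (range (\<lambda>x. x ^ m *\<^sub>R nth_vderiv n f x)))}"

text \<open>Independence of the indexed family, not of the set of its members: a repeated member makes
  the family dependent. Functions are identified when they agree almost everywhere. The index set
  is meant to be finite, so that the sum is a genuine linear combination.\<close>

definition ae_linearly_independent :: "'i set \<Rightarrow> ('i \<Rightarrow> real \<Rightarrow> complex) \<Rightarrow> bool" where
  "ae_linearly_independent I f \<longleftrightarrow>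
     (\<forall>c :: 'i \<Rightarrow> complex.
        (AE x in lborel. (\<Sum>k\<in>I. c k * f k x) = 0) \<longrightarrow> (\<forall>k\<in>I. c k = 0))"

end

theory Submission
  imports Defs "HOL-Probability.Sinc_Integral"
begin

text \<open>Keep the terms of a vanishing combination with nonzero coefficients. If one of them has a
  strictly largest dilation, the \<open>n\<close>-th derivative of \<open>\<phi>\<close> is, for large \<open>n\<close>, bounded by a proper
  fraction of its own supremum, so \<open>\<phi>\<close> is a polynomial and hence zero. Otherwise either a smaller
  dilation faces two equal larger ones, a refinement equation that is excluded by following
  the zero set of \<open>\<phi>\<close> from \<open>-\<infinity>\<close> to the right; or all dilations agree. Translates are
  handled without the Fourier transform: normality of convolution operators on \<open>L\<^sup>2\<close> supplies the
  adjoint relation, and the two relations together give a constant-coefficient recurrence in a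
  single step, which has no solution decaying in both directions.\<close>

section \<open>A supremum contraction principle\<close>

text \<open>Taking \<open>M\<close> to be the supremum of \<open>norm (f y)\<close> over
  \<open>S\<close> gives \<open>M \<le> q * M\<close>, which leaves only \<open>M \<le> 0\<close>.
  Boundedness makes this supremum meaningful.\<close>

lemma contraction_zero:
  fixes f :: "'a \<Rightarrow> 'b::real_normed_vector"
  assumes bdd: "bounded (f ` S)" and q: "q < 1" and "x \<in> S"
    and contr: "\<And>M y. y \<in> S \<Longrightarrow> (\<And>z. z \<in> S \<Longrightarrow> norm (f z) \<le> M) \<Longrightarrow> norm (f y) \<le> q * M"
  shows "f x = 0"
proof -
  define M where "M = (SUP y\<in>S. norm (f y))"
  have "bdd_above ((\<lambda>y. norm (f y)) ` S)"
    using bdd by (auto simp: bounded_iff bdd_above_def)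
  then have le: "norm (f y) \<le> M" if "y \<in> S" for y
    unfolding M_def using that by (rule cSUP_upper2) auto
  have "M \<le> q * M"
    unfolding M_def
    by (rule cSUP_least) (use \<open>x \<in> S\<close> contr le in \<open>auto simp: M_def\<close>)
  then have "(1 - q) * M \<le> 0"
    by (simp add: algebra_simps)
  then have "M \<le> 0"
    using q by (simp add: mult_le_0_iff)
  then show ?thesis
    using le[OF \<open>x \<in> S\<close>] by (metis norm_le_zero_iff order_trans)
qed

section \<open>Derivatives and decay of Schwartz functions\<close>

lemma nth_vderiv_0 [simp]: "nth_vderiv 0 f = f"
  by (simp add: nth_vderiv_def)

lemma schwartz_has_vderiv:
  assumes "\<phi> \<in> schwartz_space"
  shows "(nth_vderiv n \<phi> has_vector_derivative nth_vderiv (Suc n) \<phi> x) (at x)"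
  using assms by (auto simp: schwartz_space_def nth_vderiv_def vector_derivative_works)

lemma schwartz_continuous:
  assumes "\<phi> \<in> schwartz_space"
  shows "continuous_on A \<phi>"
  using has_vector_derivative_continuous[OF schwartz_has_vderiv[OF assms, of 0]]
  by (intro continuous_at_imp_continuous_on) simp

lemma schwartz_bound:
  assumes "\<phi> \<in> schwartz_space"
  obtains B where "\<And>x. \<bar>x\<bar> ^ m * norm (nth_vderiv n \<phi> x) \<le> B"
proof -
  have "bounded (range (\<lambda>x. x ^ m *\<^sub>R nth_vderiv n \<phi> x))"
    using assms by (simp add: schwartz_space_def)
  then show ?thesis
    using that by (auto simp: bounded_iff power_abs)
qed

lemma schwartz_bounded:
  assumes "\<phi> \<in> schwartz_space"
  shows "bounded (nth_vderiv n \<phi> ` S)"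
proof -
  obtain B where "\<And>x. \<bar>x\<bar> ^ 0 * norm (nth_vderiv n \<phi> x) \<le> B"
    using schwartz_bound[OF assms] by blast
  then show ?thesis
    by (auto simp: bounded_iff)
qed

lemma schwartz_tendsto_0:
  assumes "\<phi> \<in> schwartz_space"
  shows "(nth_vderiv n \<phi> \<longlongrightarrow> 0) at_infinity"
proof -
  obtain B where B: "\<And>x. \<bar>x\<bar> ^ 1 * norm (nth_vderiv n \<phi> x) \<le> B"
    using schwartz_bound[OF assms] by blast
  show ?thesis
  proof (rule Lim_null_comparison)
    show "\<forall>\<^sub>F x in at_infinity. norm (nth_vderiv n \<phi> x) \<le> B / norm x"
      unfolding eventually_at_infinity
      by (rule exI[of _ 1]) (use B in \<open>auto simp: field_simps\<close>)
    show "((\<lambda>x::real. B / norm x) \<longlongrightarrow> 0) at_infinity"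
      by (intro tendsto_divide_0[OF tendsto_const] filterlim_at_top_imp_at_infinity filterlim_norm_at_top)
  qed
qed

text \<open>The weight is centred at \<open>p\<close> instead of 0. Since
  \<open>\<bar>y\<bar>\<close> is at most twice the larger of \<open>\<bar>p + y\<bar>\<close> and
  \<open>\<bar>p\<bar>\<close>, the Schwartz bounds of orders \<open>N\<close> and 0
  suffice.\<close>

lemma schwartz_bounded_weight_shift:
  assumes "\<phi> \<in> schwartz_space"
  shows "bounded ((\<lambda>y. y ^ N *\<^sub>R \<phi> (p + y)) ` S)"
proof -
  obtain B where B: "\<And>x. \<bar>x\<bar> ^ N * norm (\<phi> x) \<le> B"
    using schwartz_bound[OF assms, of N 0] by auto
  obtain C where C: "\<And>x. norm (\<phi> x) \<le> C"
    using schwartz_bound[OF assms, of 0 0] by auto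
  have "norm (y ^ N *\<^sub>R \<phi> (p + y)) \<le> 2 ^ N * (B + \<bar>p\<bar> ^ N * C)" for y
  proof -
    have "\<bar>y\<bar> \<le> \<bar>p + y\<bar> + \<bar>p\<bar>"
      by simp
    also have "\<dots> \<le> 2 * max \<bar>p + y\<bar> \<bar>p\<bar>"
      by (simp add: max_def)
    finally have "\<bar>y\<bar> \<le> 2 * max \<bar>p + y\<bar> \<bar>p\<bar>" .
    then have "\<bar>y\<bar> ^ N \<le> (2 * max \<bar>p + y\<bar> \<bar>p\<bar>) ^ N"
      by (intro power_mono) auto
    also have "\<dots> \<le> 2 ^ N * (\<bar>p + y\<bar> ^ N + \<bar>p\<bar> ^ N)"
      by (auto simp: power_mult_distrib max_def)
    finally have "\<bar>y\<bar> ^ N * norm (\<phi> (p + y)) \<le> 2 ^ N * (\<bar>p + y\<bar> ^ N + \<bar>p\<bar> ^ N) * norm (\<phi> (p + y))"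
      by (rule mult_right_mono) simp
    also have "\<dots> = 2 ^ N * (\<bar>p + y\<bar> ^ N * norm (\<phi> (p + y)) + \<bar>p\<bar> ^ N * norm (\<phi> (p + y)))"
      by (simp add: algebra_simps)
    also have "\<dots> \<le> 2 ^ N * (B + \<bar>p\<bar> ^ N * C)"
      by (intro mult_left_mono add_mono B C) auto
    finally show ?thesis
      by (simp add: power_abs)
  qed
  then show ?thesis
    by (auto simp: bounded_iff)
qed

text \<open>Where the derivative of order \<open>n + 1\<close> vanishes, the one of order
  \<open>n\<close> is constant, and decay at minus infinity makes that constant 0. Lowering the
  order step by step reaches \<open>\<phi>\<close>.\<close>

lemma schwartz_zero_if_nth_vderiv_zero:
  assumes \<phi>: "\<phi> \<in> schwartz_space"
    and "\<And>x. x < c \<Longrightarrow> nth_vderiv n \<phi> x = 0" and "x < c"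
  shows "\<phi> x = 0"
  using assms(2,3)
proof (induction n arbitrary: x)
  case 0
  then show ?case by simp
next
  case (Suc n)
  obtain k where "\<And>x. x \<in> {..<c} \<Longrightarrow> nth_vderiv n \<phi> x = k"
  proof (rule has_vector_derivative_zero_constant)
    show "(nth_vderiv n \<phi> has_vector_derivative 0) (at x within {..<c})" if "x \<in> {..<c}" for x
      using schwartz_has_vderiv[OF \<phi>, of n x] Suc.prems(1)[of x] that
      by (auto intro: has_vector_derivative_at_within)
  qed auto
  then have k: "\<And>x. x < c \<Longrightarrow> nth_vderiv n \<phi> x = k"
    by auto
  have "(nth_vderiv n \<phi> \<longlongrightarrow> 0) at_bot"
    using schwartz_tendsto_0[OF \<phi>] by (rule tendsto_mono[OF at_bot_le_at_infinity])
  moreover have "(nth_vderiv n \<phi> \<longlongrightarrow> k) at_bot"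
    by (rule tendsto_eventually) (use k in \<open>auto intro: eventually_mono[OF eventually_gt_at_bot] simp: eventually_at_bot_dense\<close>)
  ultimately have "k = 0"
    using tendsto_unique trivial_limit_at_bot_linorder by blast
  then show ?case
    using Suc.IH k Suc.prems(2) by simp
qed

section \<open>Differentiated relations and the largest dilation\<close>

text \<open>By the chain rule each differentiation multiplies the term of index \<open>k\<close> by
  \<open>lam k\<close>. These powers are what later separates larger from smaller dilations.\<close>

lemma nth_vderiv_relation:
  assumes \<phi>: "\<phi> \<in> schwartz_space"
    and rel: "\<And>x. (\<Sum>k\<in>J. c k * \<phi> (lam k * x - b k)) = 0"
  shows "(\<Sum>k\<in>J. c k * of_real (lam k) ^ n * nth_vderiv n \<phi> (lam k * x - b k)) = 0"
proof (induction n arbitrary: x)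
  case 0
  then show ?case using rel by simp
next
  case (Suc n)
  let ?F = "\<lambda>x. \<Sum>k\<in>J. c k * of_real (lam k) ^ n * nth_vderiv n \<phi> (lam k * x - b k)"
  have "((\<lambda>x. nth_vderiv n \<phi> (lam k * x - b k)) has_vector_derivative
      lam k *\<^sub>R nth_vderiv (Suc n) \<phi> (lam k * x - b k)) (at x)" for k
  proof -
    have "((\<lambda>x. lam k * x - b k) has_vector_derivative lam k) (at x)"
      by (auto intro!: derivative_eq_intros)
    from vector_diff_chain_at[OF this schwartz_has_vderiv[OF \<phi>]] show ?thesis
      by (simp add: o_def)
  qed
  then have "(?F has_vector_derivative (\<Sum>k\<in>J. c k * of_real (lam k) ^ n *
      (lam k *\<^sub>R nth_vderiv (Suc n) \<phi> (lam k * x - b k)))) (at x)"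
    by (intro has_vector_derivative_sum has_vector_derivative_mult_right)
  then have "((\<lambda>x. 0) has_vector_derivative (\<Sum>k\<in>J. c k * of_real (lam k) ^ n *
      (lam k *\<^sub>R nth_vderiv (Suc n) \<phi> (lam k * x - b k)))) (at x)"
    by (simp only: Suc.IH)
  then have "(\<Sum>k\<in>J. c k * of_real (lam k) ^ n *
      (lam k *\<^sub>R nth_vderiv (Suc n) \<phi> (lam k * x - b k))) = 0"
    by (rule vector_derivative_unique_at[OF _ has_vector_derivative_const])
  then show ?case
    by (simp add: scaleR_conv_of_real algebra_simps)
qed

text \<open>Differentiating \<open>n\<close> times makes the coefficient of the largest dilation dominate.\<close>

lemma schwartz_zero_if_unique_largest_dilation:
  assumes \<phi>: "\<phi> \<in> schwartz_space"
    and rel: "\<And>x. (\<Sum>k\<in>J. c k * \<phi> (lam k * x - b k)) = 0"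
    and J: "finite J" "i \<in> J" "c i \<noteq> 0"
    and pos: "\<And>k. k \<in> J \<Longrightarrow> lam k > 0"
    and max: "\<And>k. k \<in> J - {i} \<Longrightarrow> lam k < lam i"
  shows "\<phi> = (\<lambda>x. 0)"
proof -
  \<comment> \<open>\<open>q n\<close> measures the other coefficients against that of index
    \<open>i\<close> after \<open>n\<close> differentiations; it tends to 0 because every ratio
    \<open>lam k / lam i\<close> is below 1.\<close>
  define q where "q n = (\<Sum>k\<in>J - {i}. norm (c k) / norm (c i) * (lam k / lam i) ^ n)" for n
  have "q \<longlonglongrightarrow> (\<Sum>k\<in>J - {i}. norm (c k) / norm (c i) * 0)"
    unfolding q_def
    by (intro tendsto_intros LIMSEQ_realpow_zero)
       (use pos max J in \<open>auto intro: less_imp_le simp: divide_simps\<close>)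
  then have "\<forall>\<^sub>F n in sequentially. q n < 1"
    by (intro order_tendstoD(2)[of q 0]) auto
  then obtain n where n: "q n < 1"
    by (auto simp: eventually_sequentially)
  let ?D = "nth_vderiv n \<phi>"
  have li: "lam i > 0"
    using pos J by simp
  have D0: "?D x = 0" for x
  proof (rule contraction_zero[OF schwartz_bounded[OF \<phi>, of n UNIV] n])
    fix M y
    assume M: "\<And>z. z \<in> UNIV \<Longrightarrow> norm (?D z) \<le> M"
    define x where "x = (y + b i) / lam i"
    have y: "lam i * x - b i = y"
      using li by (simp add: x_def)
    have "c i * of_real (lam i) ^ n * ?D y =
        - (\<Sum>k\<in>J - {i}. c k * of_real (lam k) ^ n * ?D (lam k * x - b k))"
      using nth_vderiv_relation[OF \<phi> rel, of n x] J
      by (simp add: sum.remove[of J i] y eq_neg_iff_add_eq_0)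
    then have "norm (c i * of_real (lam i) ^ n * ?D y) \<le>
        (\<Sum>k\<in>J - {i}. norm (c k * of_real (lam k) ^ n * ?D (lam k * x - b k)))"
      by (simp only: norm_minus_cancel norm_sum)
    then have "norm (c i) * lam i ^ n * norm (?D y) \<le>
        (\<Sum>k\<in>J - {i}. norm (c k) * \<bar>lam k\<bar> ^ n * norm (?D (lam k * x - b k)))"
      using li by (simp add: norm_mult norm_power)
    also have "\<dots> \<le> (\<Sum>k\<in>J - {i}. norm (c k) * lam k ^ n * M)"
      using pos M by (intro sum_mono mult_mono) (auto simp: less_imp_le)
    also have "\<dots> = norm (c i) * lam i ^ n * (q n * M)"
      using li J by (simp add: q_def sum_distrib_left sum_distrib_right power_divide field_simps)
    finally show "norm (?D y) \<le> q n * M"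
      using li J by simp
  qed simp
  show ?thesis
    using schwartz_zero_if_nth_vderiv_zero[OF \<phi>, of _ n] D0 by (metis lt_ex gt_ex)
qed

section \<open>Refinement equations\<close>

lemma power_small:
  fixes r A :: real
  assumes "0 \<le> r" "r < 1"
  obtains n where "A * r ^ n < 1"
proof -
  have "(\<lambda>n. A * r ^ n) \<longlonglongrightarrow> A * 0"
    using assms by (intro tendsto_intros LIMSEQ_realpow_zero)
  then have "\<forall>\<^sub>F n in sequentially. A * r ^ n < 1"
    by (intro order_tendstoD(2)) auto
  then show ?thesis
    using that by (auto simp: eventually_sequentially)
qed

text \<open>Both maps on the right-hand side expand and push the half-line to the left of \<open>p\<close> away from
  \<open>p\<close>, so decay at \<open>-\<infinity>\<close> makes the function vanish there. Contracting a high derivative towards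
  \<open>p\<close> then extends the zero set to the right in steps of length \<open>g\<close>.\<close>

lemma schwartz_refinement_zero:
  fixes L g p :: real and a b :: complex
  assumes \<phi>: "\<phi> \<in> schwartz_space"
    and ref: "\<And>n y. nth_vderiv n \<phi> (p + y) = of_real L ^ n *
        (a * nth_vderiv n \<phi> (p + L * y) + b * nth_vderiv n \<phi> (p + L * y - g))"
    and L: "L > 1" and g: "g > 0" and a: "a \<noteq> 0"
  shows "\<phi> = (\<lambda>x. 0)"
proof -
  have r: "0 \<le> 1 / L" "1 / L < 1"
    using L by auto
  have left: "\<phi> (p + y) = 0" if "y < 0" for y
  proof -
    \<comment> \<open>Expansion by \<open>L\<close> raises the weight
      \<open>\<bar>y\<bar> ^ N\<close> by a factor of at least \<open>L ^ N\<close>, so a large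
      \<open>N\<close> beats the coefficients \<open>a\<close> and \<open>b\<close>.\<close>
    obtain N where N: "(norm a + norm b) * (1 / L) ^ N < 1"
      using power_small[OF r] by blast
    let ?f = "\<lambda>y. y ^ N *\<^sub>R \<phi> (p + y)"
    have "?f y = 0"
    proof (rule contraction_zero[OF schwartz_bounded_weight_shift[OF \<phi>, where S = "{..<0}"] N])
      fix M y
      assume y: "y \<in> {..<(0::real)}" and M: "\<And>z. z \<in> {..<0} \<Longrightarrow> norm (?f z) \<le> M"
      have "L * y < 0"
        using L y by (simp add: mult_pos_neg)
      with g have Ly: "L * y < 0" "L * y - g < 0"
        by auto
      have 1: "L ^ N * (\<bar>y\<bar> ^ N * norm (\<phi> (p + L * y))) \<le> M"
        using M[of "L * y"] Ly L by (simp add: abs_mult power_mult_distrib power_abs)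
      have "L ^ N * (\<bar>y\<bar> ^ N * norm (\<phi> (p + L * y - g))) = (L * \<bar>y\<bar>) ^ N * norm (\<phi> (p + L * y - g))"
        by (simp add: power_mult_distrib)
      \<comment> \<open>As \<open>L * y\<close> is negative and \<open>g\<close> positive,
        subtracting \<open>g\<close> only increases the absolute value.\<close>
      also have "\<dots> \<le> \<bar>L * y - g\<bar> ^ N * norm (\<phi> (p + L * y - g))"
        using L g Ly y by (intro mult_right_mono power_mono) auto
      also have "\<dots> \<le> M"
        using M[of "L * y - g"] Ly by (simp add: power_abs add_diff_eq)
      finally have 2: "L ^ N * (\<bar>y\<bar> ^ N * norm (\<phi> (p + L * y - g))) \<le> M" .
      have "norm (?f y) = \<bar>y\<bar> ^ N * norm (a * \<phi> (p + L * y) + b * \<phi> (p + L * y - g))"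
        using ref[of 0 y] by (simp add: power_abs)
      also have "\<dots> \<le> \<bar>y\<bar> ^ N * (norm a * norm (\<phi> (p + L * y)) + norm b * norm (\<phi> (p + L * y - g)))"
        by (intro mult_left_mono norm_triangle_mono) (auto simp: norm_mult)
      finally have "L ^ N * norm (?f y) \<le> L ^ N * (\<bar>y\<bar> ^ N *
          (norm a * norm (\<phi> (p + L * y)) + norm b * norm (\<phi> (p + L * y - g))))"
        using L by (intro mult_left_mono) auto
      also have "\<dots> = norm a * (L ^ N * (\<bar>y\<bar> ^ N * norm (\<phi> (p + L * y))))
          + norm b * (L ^ N * (\<bar>y\<bar> ^ N * norm (\<phi> (p + L * y - g))))"
        by (simp add: algebra_simps)
      also have "\<dots> \<le> norm a * M + norm b * M"
        by (intro add_mono mult_left_mono 1 2) auto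
      finally show "norm (?f y) \<le> (norm a + norm b) * (1 / L) ^ N * M"
        using L by (simp add: field_simps)
    qed (use that in auto)
    then show ?thesis
      using that by simp
  qed
  \<comment> \<open>Solving the refinement equation for the value at \<open>y\<close> divides by
    \<open>a * L ^ n\<close>, a contraction once \<open>n\<close> is large.\<close>
  obtain n where n: "1 / norm a * (1 / L) ^ n < 1"
    using power_small[OF r] by blast
  let ?D = "nth_vderiv n \<phi>"
  have step: "\<phi> x = 0" if "x < p + real m * g" for m x
    using that
  proof (induction m arbitrary: x)
    case 0
    then show ?case
      using left[of "x - p"] by simp
  next
    case (Suc m)
    \<comment> \<open>The zero set found so far contains an open half-line, so all derivatives
      vanish there as well.\<close>
    have Dz: "nth_vderiv j \<phi> z = 0" if "z < p + real m * g" for j z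
      using that
    proof (induction j arbitrary: z)
      case 0
      then show ?case using Suc.IH by simp
    next
      case (Suc j)
      have "(nth_vderiv j \<phi> has_vector_derivative 0) (at z)"
        by (rule has_vector_derivative_transform_within_open[of "\<lambda>x. 0" _ _ "{..<p + real m * g}"])
           (use Suc in auto)
      then show ?case
        using schwartz_has_vderiv[OF \<phi>] vector_derivative_unique_at by blast
    qed
    have "?D x = 0" if "x < p + real (Suc m) * g" for x
    proof (rule contraction_zero[OF schwartz_bounded[OF \<phi>] n])
      show "x \<in> {..<p + real (Suc m) * g}"
        using that by simp
    next
      fix M y
      assume y: "y \<in> {..<p + real (Suc m) * g}"
        and M: "\<And>z. z \<in> {..<p + real (Suc m) * g} \<Longrightarrow> norm (?D z) \<le> M"
      \<comment> \<open>\<open>p + u\<close> is the preimage of \<open>y\<close> under the expansion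
        about \<open>p\<close>; the second argument, \<open>y - g\<close>, falls into the half-line
        where everything already vanishes.\<close>
      define u where "u = (y - p) / L"
      have Lu: "L * u = y - p"
        using L by (simp add: u_def)
      have "?D (p + u) = of_real L ^ n * (a * ?D y + b * ?D (y - g))"
        using ref[of n u] by (simp add: Lu)
      also have "?D (y - g) = 0"
        using y by (intro Dz) (auto simp: algebra_simps)
      finally have "norm (?D (p + u)) = L ^ n * norm a * norm (?D y)"
        using L by (simp add: norm_mult norm_power)
      \<comment> \<open>Division by \<open>L\<close> moves \<open>y - p\<close> towards 0, so its
        positive upper bound persists and \<open>p + u\<close> stays in the half-line.\<close>
      moreover have "u < real (Suc m) * g"
      proof -
        have "L * u < real (Suc m) * g"
          using y Lu by auto
        also have "\<dots> \<le> L * (real (Suc m) * g)"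
          using L g mult_right_mono[of 1 L "real (Suc m) * g"] by simp
        finally show ?thesis
          using L by simp
      qed
      then have "norm (?D (p + u)) \<le> M"
        by (intro M) auto
      ultimately show "norm (?D y) \<le> 1 / norm a * (1 / L) ^ n * M"
        using L a by (simp add: field_simps)
    qed
    then show ?case
      using schwartz_zero_if_nth_vderiv_zero[OF \<phi>, of "p + real (Suc m) * g" n] Suc.prems by blast
  qed
  show ?thesis
  proof
    fix x
    obtain m where "(x - p) / g < real m"
      using reals_Archimedean2 by blast
    then show "\<phi> x = 0"
      using g by (intro step[of _ m]) (simp add: field_simps)
  qed
qed

text \<open>Dividing by the term with the smaller dilation and centring the variable at a fixed
  point yields the normal form of \<open>schwartz_refinement_zero\<close>, with
  \<open>g = b j - b i\<close>.\<close>

lemma schwartz_zero_if_two_equal_larger_dilations: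
  assumes \<phi>: "\<phi> \<in> schwartz_space"
    and rel: "\<And>x. (\<Sum>k\<in>{h, i, j}. c k * \<phi> (lam k * x - b k)) = 0"
    and dist: "distinct [h, i, j]" and c: "c h \<noteq> 0" "c i \<noteq> 0"
    and lam: "0 < lam h" "lam h < lam i" "lam j = lam i" and b: "b i < b j"
  shows "\<phi> = (\<lambda>x. 0)"
proof -
  define L where "L = lam i / lam h"
  have L: "L > 1" "lam i = L * lam h"
    using lam by (auto simp: L_def)
  \<comment> \<open>\<open>p\<close> is the fixed point of the map that sends the argument of the
    \<open>h\<close> term to that of the \<open>i\<close> term.\<close>
  define p where "p = (b i - L * b h) / (L - 1)"
  have "(L - 1) * p = b i - L * b h"
    using L by (simp add: p_def)
  then have p: "L * (p + b h) - b i = p"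
    by (simp add: algebra_simps)
  show ?thesis
  proof (rule schwartz_refinement_zero[OF \<phi>])
    show "L > 1" "b j - b i > 0" "- c i / c h \<noteq> 0"
      using L b c by auto
    fix n y
    define x where "x = (p + y + b h) / lam h"
    have x: "lam h * x - b h = p + y"
      using lam by (simp add: x_def)
    have "lam i * x = L * (p + y + b h)"
      using lam L by (simp add: x_def)
    then have xi: "lam i * x - b i = p + L * y" "lam j * x - b j = p + L * y - (b j - b i)"
      using p lam by (simp_all add: algebra_simps)
    let ?D = "nth_vderiv n \<phi>"
    have "c h * of_real (lam h) ^ n * ?D (p + y) + c i * of_real (lam i) ^ n * ?D (p + L * y)
        + c j * of_real (lam i) ^ n * ?D (p + L * y - (b j - b i)) = 0"
      using nth_vderiv_relation[OF \<phi> rel, of n x] dist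
      by (simp add: x xi(1) xi(2)[unfolded lam(3)] lam(3) add.assoc)
    then have "of_real (lam h) ^ n * (c h * ?D (p + y) + of_real L ^ n * (c i * ?D (p + L * y)
        + c j * ?D (p + L * y - (b j - b i)))) = 0"
      unfolding L(2) by (simp add: power_mult_distrib algebra_simps)
    then have "c h * ?D (p + y) + of_real L ^ n * (c i * ?D (p + L * y)
        + c j * ?D (p + L * y - (b j - b i))) = 0"
      using lam by simp
    then have "?D (p + y) = - (of_real L ^ n * (c i * ?D (p + L * y)
        + c j * ?D (p + L * y - (b j - b i)))) / c h"
      using c by (simp add: nonzero_eq_divide_eq eq_neg_iff_add_eq_0 mult.commute del: divide_minus_left)
    then show "?D (p + y) = of_real L ^ n *
        (- c i / c h * ?D (p + L * y) + - c j / c h * ?D (p + L * y - (b j - b i)))"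
      using c by (simp add: field_simps)
  qed
qed

section \<open>Linear recurrences for functions vanishing at infinity\<close>

text \<open>Norms do not decrease along \<open>x + n * d\<close> if \<open>norm r \<ge> 1\<close>,
  nor along \<open>x - n * d\<close> otherwise. Either way \<open>norm (f x)\<close> is bounded by
  values tending to 0.\<close>

lemma vanishing_geometric_zero:
  fixes f :: "real \<Rightarrow> complex"
  assumes f: "(f \<longlongrightarrow> 0) at_infinity" and rel: "\<And>x. f (x + d) = r * f x" and d: "d \<noteq> 0"
  shows "f x = 0"
proof -
  have iter: "f (x + real n * d) = r ^ n * f x" for n x
  proof (induction n)
    case (Suc n)
    then show ?case
      using rel[of "x + real n * d"] by (simp add: algebra_simps)
  qed simp
  have lim: "(\<lambda>n. f (x + real n * e)) \<longlonglongrightarrow> 0" if "e \<noteq> 0" for e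
  proof (rule filterlim_compose[OF f])
    show "filterlim (\<lambda>n. x + real n * e) at_infinity sequentially"
      using that
      unfolding mult.commute[of _ e]
      by (intro tendsto_add_filterlim_at_infinity[OF tendsto_const]
          tendsto_mult_filterlim_at_infinity[OF tendsto_const]
          filterlim_at_top_imp_at_infinity filterlim_real_sequentially)
  qed
  show ?thesis
  proof (cases "norm r \<ge> 1")
    case True
    then have "norm (f x) \<le> norm (f (x + real n * d))" for n
      by (simp add: iter norm_mult norm_power mult_le_cancel_right1)
    then show ?thesis
      using lim[OF d] LIMSEQ_le_const[of "\<lambda>n. norm (f (x + real n * d))" 0 "norm (f x)"]
        tendsto_norm_zero by (metis norm_le_zero_iff)
  next
    case False
    have "norm (f x) \<le> norm (f (x + real n * (- d)))" for n
    proof -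
      have "f x = r ^ n * f (x + real n * (- d))"
        using iter[of "x + real n * (- d)" n] by simp
      moreover have "norm r ^ n \<le> 1"
        using False by (intro power_le_one) auto
      ultimately show ?thesis
        by (metis mult_left_le_one_le norm_ge_zero norm_mult norm_power zero_le_power)
    qed
    then show ?thesis
      using lim[of "- d"] d LIMSEQ_le_const[of "\<lambda>n. norm (f (x + real n * (- d)))" 0 "norm (f x)"]
        tendsto_norm_zero by (metis neg_equal_0_iff_equal norm_le_zero_iff)
  qed
qed

lemma vanishing_shift:
  fixes f :: "real \<Rightarrow> complex"
  assumes "(f \<longlongrightarrow> 0) at_infinity"
  shows "((\<lambda>x. f (x + d)) \<longlongrightarrow> 0) at_infinity"
  by (rule filterlim_compose[OF assms])
     (intro tendsto_add_filterlim_at_infinity'[OF _ tendsto_const] filterlim_ident)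

text \<open>With \<open>S\<close> the shift by \<open>d\<close>, the relation reads
  \<open>(S - r) (S - s) f = 0\<close> for the roots \<open>r\<close> and \<open>s\<close> of
  \<open>z^2 + p * z + q\<close>. The first-order factors are removed one after the other.\<close>

lemma vanishing_recurrence_zero:
  fixes f :: "real \<Rightarrow> complex"
  assumes f: "(f \<longlongrightarrow> 0) at_infinity" and d: "d \<noteq> 0"
    and rel: "\<And>x. f (x + 2 * d) + p * f (x + d) + q * f x = 0"
  shows "f x = 0"
proof -
  define r where "r = (- p + csqrt (p\<^sup>2 - 4 * q)) / 2"
  define s where "s = (- p - csqrt (p\<^sup>2 - 4 * q)) / 2"
  have rs: "r + s = - p"
    by (simp add: r_def s_def field_simps)
  have "4 * (r * s) = p\<^sup>2 - (csqrt (p\<^sup>2 - 4 * q))\<^sup>2"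
    by (simp add: r_def s_def field_simps power2_eq_square)
  then have rs': "r * s = q"
    by simp
  have geo: "f (x + d) - s * f x = 0" for x
  proof (rule vanishing_geometric_zero[OF _ _ d, of "\<lambda>x. f (x + d) - s * f x" r])
    show "((\<lambda>x. f (x + d) - s * f x) \<longlongrightarrow> 0) at_infinity"
      using tendsto_diff[OF vanishing_shift[OF f, of d] tendsto_mult_right_zero[OF f, of s]] by simp
    fix x
    have p: "p = - (r + s)"
      using rs by simp
    have "f (x + 2 * d) = (r + s) * f (x + d) - r * s * f x"
      using rel[of x] unfolding p rs'[symmetric] by algebra
    moreover have "x + d + d = x + 2 * d"
      by simp
    ultimately show "f (x + d + d) - s * f (x + d) = r * (f (x + d) - s * f x)"
      by (simp add: algebra_simps)
  qed
  show ?thesis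
    by (rule vanishing_geometric_zero[OF f _ d, of s]) (use geo in simp)
qed

section \<open>Translates and square integrals\<close>

text \<open>The zero set is closed, and a closed set with null complement is the whole line. This
  makes almost-everywhere relations pointwise.\<close>

lemma continuous_AE_zero:
  fixes f :: "real \<Rightarrow> 'a::real_normed_vector"
  assumes "continuous_on UNIV f" "AE x in lborel. f x = 0"
  shows "f x = 0"
proof -
  have "closed {x. f x = 0}"
    using assms(1) by (intro closed_Collect_eq) auto
  moreover have "AE x in lebesgue. x \<in> {x. f x = 0}"
    using assms(2) by (intro AE_completion) simp
  ultimately show ?thesis
    using mem_closed_if_AE_lebesgue[of "{x. f x = 0}" x] by simp
qed

lemma schwartz_integrable:
  assumes "\<phi> \<in> schwartz_space"
  shows "integrable lborel \<phi>"
proof -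
  obtain B where B: "\<And>x. \<bar>x\<bar> ^ 2 * norm (\<phi> x) \<le> B"
    using schwartz_bound[OF assms, of 2 0] by auto
  obtain C where C: "\<And>x. norm (\<phi> x) \<le> C"
    using schwartz_bound[OF assms, of 0 0] by auto
  have "integrable lborel (\<lambda>x::real. inverse (1 + x\<^sup>2))"
    using integrable_inverse_1_plus_square by (simp add: set_integrable_def)
  then have "integrable lborel (\<lambda>x::real. (B + C) * inverse (1 + x\<^sup>2))"
    by (rule integrable_mult_right)
  then show ?thesis
  proof (rule Bochner_Integration.integrable_bound)
    show "\<phi> \<in> borel_measurable lborel"
      using schwartz_continuous[OF assms, of UNIV] by (simp add: borel_measurable_continuous_onI)
    have "norm (\<phi> x) \<le> (B + C) * inverse (1 + x\<^sup>2)" for x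
    proof -
      have "norm (\<phi> x) * (1 + x\<^sup>2) \<le> B + C"
        using add_mono[OF B[of x] C[of x]] by (simp add: algebra_simps)
      moreover have "0 < 1 + x\<^sup>2"
        by (simp add: add_pos_nonneg)
      ultimately show ?thesis
        by (simp add: field_simps)
    qed
    then show "AE x in lborel. norm (\<phi> x) \<le> norm ((B + C) * inverse (1 + x\<^sup>2))"
      by (intro AE_I2) (metis abs_ge_self order_trans real_norm_def)
  qed
qed

lemma schwartz_integrable_mult_cnj:
  assumes \<phi>: "\<phi> \<in> schwartz_space"
  shows "integrable lborel (\<lambda>x. \<phi> (x + s) * cnj (\<phi> (x + t)))"
proof -
  obtain C where C: "\<And>x. norm (\<phi> x) \<le> C"
    using schwartz_bound[OF \<phi>, of 0 0] by auto
  have "integrable lborel (\<lambda>x. \<phi> (x + s))"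
    using lborel_integrable_real_affine[OF schwartz_integrable[OF \<phi>], of 1 s] by (simp add: add.commute)
  then have "integrable lborel (\<lambda>x. of_real C * \<phi> (x + s))"
    by simp
  then show ?thesis
  proof (rule Bochner_Integration.integrable_bound)
    have "continuous_on UNIV (\<lambda>x. \<phi> (x + s) * cnj (\<phi> (x + t)))"
      by (intro continuous_intros continuous_on_compose2[OF schwartz_continuous[OF \<phi>, of UNIV]]) auto
    then show "(\<lambda>x. \<phi> (x + s) * cnj (\<phi> (x + t))) \<in> borel_measurable lborel"
      by (simp add: borel_measurable_continuous_onI)
    have "norm (\<phi> (x + s) * cnj (\<phi> (x + t))) \<le> norm (of_real C * \<phi> (x + s))" for x
      using C[of "x + t"] mult_right_mono[OF order_trans[OF C[of "x + t"] abs_ge_self], of "norm (\<phi> (x + s))"]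
      by (simp add: norm_mult mult.commute)
    then show "AE x in lborel. norm (\<phi> (x + s) * cnj (\<phi> (x + t))) \<le> norm (of_real C * \<phi> (x + s))"
      by simp
  qed
qed

text \<open>A polynomial \<open>T\<close> in the commuting unitary translation operators is normal on \<open>L\<^sup>2\<close>, so \<open>T\<close> and
  its adjoint have the same kernel.\<close>

lemma schwartz_adjoint_translates:
  assumes \<phi>: "\<phi> \<in> schwartz_space" and J: "finite J"
    and rel: "\<And>x. (\<Sum>k\<in>J. c k * \<phi> (x - b k)) = 0"
  shows "(\<Sum>k\<in>J. cnj (c k) * \<phi> (x + b k)) = 0"
proof -
  \<comment> \<open>\<open>R\<close> is the autocorrelation of \<open>\<phi>\<close>: by translation
    invariance, the inner product of two translates depends only on the difference of the
    shifts.\<close>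
  define R where "R t = (LINT x|lborel. \<phi> (x + t) * cnj (\<phi> x))" for t
  have R: "(LINT x|lborel. \<phi> (x + s) * cnj (\<phi> (x + t))) = R (s - t)" for s t
    unfolding R_def
    using lborel_integral_real_affine[of 1 "\<lambda>x. \<phi> (x + (s - t)) * cnj (\<phi> x)" t]
    by (simp add: add.commute add.left_commute)
  have norm2: "integrable lborel (\<lambda>x. (\<Sum>k\<in>J. d k * \<phi> (x + e k)) * cnj (\<Sum>k\<in>J. d k * \<phi> (x + e k)))"
      "(LINT x|lborel. (\<Sum>k\<in>J. d k * \<phi> (x + e k)) * cnj (\<Sum>k\<in>J. d k * \<phi> (x + e k)))
        = (\<Sum>k\<in>J. \<Sum>l\<in>J. d k * cnj (d l) * R (e k - e l))" for d e
  proof -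
    have eq: "(\<Sum>k\<in>J. d k * \<phi> (x + e k)) * cnj (\<Sum>k\<in>J. d k * \<phi> (x + e k)) =
        (\<Sum>k\<in>J. \<Sum>l\<in>J. d k * cnj (d l) * (\<phi> (x + e k) * cnj (\<phi> (x + e l))))" for x
      by (simp add: sum_product mult_ac)
    show "integrable lborel (\<lambda>x. (\<Sum>k\<in>J. d k * \<phi> (x + e k)) * cnj (\<Sum>k\<in>J. d k * \<phi> (x + e k)))"
      unfolding eq
      by (intro Bochner_Integration.integrable_sum integrable_mult_right schwartz_integrable_mult_cnj[OF \<phi>])
    show "(LINT x|lborel. (\<Sum>k\<in>J. d k * \<phi> (x + e k)) * cnj (\<Sum>k\<in>J. d k * \<phi> (x + e k)))
        = (\<Sum>k\<in>J. \<Sum>l\<in>J. d k * cnj (d l) * R (e k - e l))"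
      unfolding eq
      by (simp add: Bochner_Integration.integral_sum schwartz_integrable_mult_cnj[OF \<phi>] R)
  qed
  let ?E = "\<lambda>x. \<Sum>k\<in>J. cnj (c k) * \<phi> (x + b k)"
  have "(\<Sum>k\<in>J. \<Sum>l\<in>J. c k * cnj (c l) * R (- b k - - b l)) = 0"
    using norm2(2)[of c "\<lambda>k. - b k"] rel by simp
  \<comment> \<open>Exchanging \<open>k\<close> and \<open>l\<close> turns the squared norm for
    \<open>c\<close> and \<open>- b\<close> into the one for \<open>cnj c\<close> and
    \<open>b\<close>: a normal operator and its adjoint give vectors of equal norm.\<close>
  also have "(\<Sum>k\<in>J. \<Sum>l\<in>J. c k * cnj (c l) * R (- b k - - b l)) =
      (\<Sum>k\<in>J. \<Sum>l\<in>J. cnj (c k) * cnj (cnj (c l)) * R (b k - b l))"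
    by (subst sum.swap) (simp add: mult_ac)
  also have "\<dots> = (LINT x|lborel. ?E x * cnj (?E x))"
    using norm2(2)[of "\<lambda>k. cnj (c k)" b] by simp
  also have "\<dots> = of_real (LINT x|lborel. (norm (?E x))\<^sup>2)"
    by (simp only: complex_norm_square[symmetric] integral_complex_of_real)
  finally have "(LINT x|lborel. (norm (?E x))\<^sup>2) = 0"
    by simp
  moreover have "integrable lborel (\<lambda>x. (norm (?E x))\<^sup>2)"
    using norm2(1)[of "\<lambda>k. cnj (c k)" b]
    by (simp only: complex_norm_square[symmetric] complex_of_real_integrable_eq)
  ultimately have "AE x in lborel. (norm (?E x))\<^sup>2 = 0"
    by (subst (asm) integral_nonneg_eq_0_iff_AE) auto
  then have "AE x in lborel. ?E x = 0"
    by simp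
  moreover have "continuous_on UNIV ?E"
    by (intro continuous_intros continuous_on_compose2[OF schwartz_continuous[OF \<phi>, of UNIV]]) auto
  ultimately show ?thesis
    using continuous_AE_zero[of ?E] by blast
qed

text \<open>Solving for the first term gives a geometric relation with step \<open>t - s\<close> and
  ratio \<open>- d / c\<close>.\<close>

lemma schwartz_two_translates_zero:
  assumes \<phi>: "\<phi> \<in> schwartz_space"
    and rel: "\<And>x. c * \<phi> (x - s) + d * \<phi> (x - t) = 0" and "c \<noteq> 0" "s \<noteq> t"
  shows "\<phi> = (\<lambda>x. 0)"
proof
  fix x
  show "\<phi> x = 0"
  proof (rule vanishing_geometric_zero[of _ "t - s" "- d / c"])
    show "(\<phi> \<longlongrightarrow> 0) at_infinity"
      using schwartz_tendsto_0[OF \<phi>, of 0] by simp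
    show "\<phi> (x + (t - s)) = - d / c * \<phi> x" for x
      using rel[of "x + t"] \<open>c \<noteq> 0\<close> by (simp add: field_simps eq_neg_iff_add_eq_0)
  qed (use \<open>s \<noteq> t\<close> in simp)
qed

text \<open>Eliminating between the relation and its adjoint leaves a recurrence in the single step
  \<open>b j - b i\<close>, whether or not the shifts are commensurable.\<close>

lemma schwartz_three_translates_zero:
  assumes \<phi>: "\<phi> \<in> schwartz_space"
    and rel: "\<And>x. (\<Sum>k\<in>{h, i, j}. c k * \<phi> (x - b k)) = 0"
    and dist: "distinct [h, i, j]" and c: "c i \<noteq> 0" "c j \<noteq> 0" and b: "b i \<noteq> b j"
  shows "\<phi> = (\<lambda>x. 0)"
proof
  fix x
  have e: "c h * \<phi> (x - b h) + c i * \<phi> (x - b i) + c j * \<phi> (x - b j) = 0" for x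
    using rel[of x] dist by (simp add: add.assoc)
  have e': "cnj (c h) * \<phi> (x + b h) + cnj (c i) * \<phi> (x + b i) + cnj (c j) * \<phi> (x + b j) = 0" for x
    using schwartz_adjoint_translates[OF \<phi> _ rel, of x] dist by (simp add: add.assoc)
  define d where "d = b j - b i"
  define A where "A = c i * cnj (c j)"
  define B where "B = c i * cnj (c i) + c j * cnj (c j) - c h * cnj (c h)"
  have A: "A \<noteq> 0"
    using c by (simp add: A_def)
  show "\<phi> x = 0"
  proof (rule vanishing_recurrence_zero[of _ d "B / A" "cnj A / A"])
    show "(\<phi> \<longlongrightarrow> 0) at_infinity"
      using schwartz_tendsto_0[OF \<phi>, of 0] by simp
    show "d \<noteq> 0"
      using b by (simp add: d_def)
    fix x
    define y where "y = x + d"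
    have 1: "c h * \<phi> y + c i * \<phi> (y + b h - b i) + c j * \<phi> (y + b h - b j) = 0"
      using e[of "y + b h"] by simp
    have 2: "cnj (c h) * \<phi> (y + b h - b i) + cnj (c i) * \<phi> y + cnj (c j) * \<phi> (y + d) = 0"
      using e'[of "y - b i"] by (simp add: d_def algebra_simps)
    have 3: "cnj (c h) * \<phi> (y + b h - b j) + cnj (c i) * \<phi> (y - d) + cnj (c j) * \<phi> y = 0"
      using e'[of "y - b j"] by (simp add: d_def algebra_simps)
    \<comment> \<open>Add \<open>c i\<close> times \<open>2\<close> and \<open>c j\<close> times
      \<open>3\<close>, then subtract \<open>cnj (c h)\<close> times \<open>1\<close>: the values at
      \<open>y + b h - b i\<close> and \<open>y + b h - b j\<close> cancel.\<close>
    have "A * \<phi> (y + d) + B * \<phi> y + cnj A * \<phi> (y - d) = 0"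
      using 1 2 3 unfolding A_def B_def complex_cnj_mult complex_cnj_cnj by algebra
    then show "\<phi> (x + 2 * d) + B / A * \<phi> (x + d) + cnj A / A * \<phi> x = 0"
      using A by (simp add: y_def field_simps)
  qed
qed

section \<open>Case analysis on the dilations\<close>

theorem corollary3p2:
  fixes \<phi> :: "real \<Rightarrow> complex" and lam \<beta> :: "nat \<Rightarrow> real"
  assumes "\<phi> \<in> schwartz_space - {\<lambda>x. 0}"
    and "\<forall>k\<in>{1..3}. lam k > 0"
    and "inj_on (\<lambda>k. (lam k, \<beta> k)) {1..3}"
  shows "ae_linearly_independent {1..3} (\<lambda>k x. \<phi> (lam k * x - \<beta> k))"
  unfolding ae_linearly_independent_def
proof (intro allI impI ballI, rule ccontr)
  fix c :: "nat \<Rightarrow> complex" and k0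
  assume ae: "AE x in lborel. (\<Sum>k\<in>{1..3}. c k * \<phi> (lam k * x - \<beta> k)) = 0"
    and k0: "k0 \<in> {1..3}" "c k0 \<noteq> 0"
  have \<phi>: "\<phi> \<in> schwartz_space" and nz: "\<phi> \<noteq> (\<lambda>x. 0)"
    using assms(1) by auto
  define J where "J = {k\<in>{1..3}. c k \<noteq> 0}"
  have J: "finite J" "J \<subseteq> {1..3}" "J \<noteq> {}" and cJ: "\<And>k. k \<in> J \<Longrightarrow> c k \<noteq> 0"
    and pos: "\<And>k. k \<in> J \<Longrightarrow> lam k > 0"
    using k0 assms(2) by (auto simp: J_def)
  have cont: "continuous_on UNIV (\<lambda>x. \<Sum>k\<in>{1..3}. c k * \<phi> (lam k * x - \<beta> k))"
    by (intro continuous_intros continuous_on_compose2[OF schwartz_continuous[OF \<phi>, of UNIV]]) auto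
  have rel: "(\<Sum>k\<in>J. c k * \<phi> (lam k * x - \<beta> k)) = 0" for x
    using continuous_AE_zero[OF cont ae, of x]
    by (subst (asm) sum.mono_neutral_right[of _ J]) (auto simp: J_def)
  have inj: "\<beta> k \<noteq> \<beta> l" if "k \<in> J" "l \<in> J" "k \<noteq> l" "lam k = lam l" for k l
  proof
    assume "\<beta> k = \<beta> l"
    with that have "(lam k, \<beta> k) = (lam l, \<beta> l)"
      by simp
    moreover have "k \<in> {1..3}" "l \<in> {1..3}"
      using that J(2) by blast+
    ultimately have "k = l"
      by (rule inj_onD[OF assms(3)])
    then show False
      using that by simp
  qed
  obtain i where i: "i \<in> J" "\<And>k. k \<in> J \<Longrightarrow> lam k \<le> lam i"
  proof -
    have "Max (lam ` J) \<in> lam ` J"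
      using J by (intro Max_in) auto
    then obtain i where "i \<in> J" "lam i = Max (lam ` J)"
      by (metis imageE)
    then show ?thesis
      using that J(1) by simp
  qed
  \<comment> \<open>A term alone at the largest dilation, as when \<open>J\<close> is a singleton,
    would force \<open>\<phi>\<close> to be zero.\<close>
  have "\<exists>j\<in>J. j \<noteq> i \<and> lam j = lam i"
  proof (rule ccontr)
    assume "\<not> ?thesis"
    then have "lam k < lam i" if "k \<in> J - {i}" for k
      using i(2)[of k] that by force
    then show False
      using schwartz_zero_if_unique_largest_dilation[OF \<phi> rel J(1) i(1) cJ[OF i(1)] pos] nz by blast
  qed
  then obtain j where j: "j \<in> J" "j \<noteq> i" "lam j = lam i"
    by blast
  show False
  proof (cases "J = {i, j}")
    case True
    \<comment> \<open>Evaluating at \<open>x / lam i\<close> removes the common dilation.\<close>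
    have "c i * \<phi> (x - \<beta> i) + c j * \<phi> (x - \<beta> j) = 0" for x
      using rel[of "x / lam i"] j pos[OF i(1)] by (simp add: True)
    from schwartz_two_translates_zero[OF \<phi> this cJ[OF i(1)] inj[OF i(1) j(1)]] show False
      using j nz by simp
  next
    case False
    then obtain h where h: "h \<in> J" "h \<noteq> i" "h \<noteq> j"
      using i j by auto
    have "card {h, i, j} = 3"
      using h j by simp
    moreover have "card J \<le> 3"
      using card_mono[OF _ J(2)] by simp
    ultimately have Jeq: "J = {h, i, j}"
      using card_seteq[of J "{h, i, j}"] J(1) h i j by auto
    show False
    proof (cases "lam h = lam i")
      case True
      have "(\<Sum>k\<in>{h, i, j}. c k * \<phi> (x - \<beta> k)) = 0" for x
        using rel[of "x / lam i"] j True pos[OF i(1)] h by (simp add: Jeq)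
      from schwartz_three_translates_zero[OF \<phi> this] show False
        using cJ[OF i(1)] cJ[OF j(1)] h j inj[OF i(1) j(1)] nz by simp
    next
      case False
      then have less: "lam h < lam i"
        using i(2)[OF h(1)] by simp
      have rel': "(\<Sum>k\<in>{h, i, j}. c k * \<phi> (lam k * x - \<beta> k)) = 0"
          "(\<Sum>k\<in>{h, j, i}. c k * \<phi> (lam k * x - \<beta> k)) = 0" for x
        using rel[of x] by (simp_all add: Jeq insert_commute)
      \<comment> \<open>The refinement argument needs a positive residual shift, so \<open>i\<close>
        and \<open>j\<close> trade places when \<open>\<beta> j\<close> is the smaller;
        \<open>rel'\<close> holds both orders.\<close>
      consider "\<beta> i < \<beta> j" | "\<beta> j < \<beta> i"
        using inj[OF i(1) j(1)] j by fastforce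
      then show False
      proof cases
        case 1
        have "distinct [h, i, j]"
          using h j by simp
        from schwartz_zero_if_two_equal_larger_dilations[OF \<phi> rel'(1) this cJ[OF h(1)]
            cJ[OF i(1)] pos[OF h(1)] less j(3) 1] show False
          using nz by contradiction
      next
        case 2
        have "distinct [h, j, i]" "lam h < lam j" "lam i = lam j"
          using h j less by simp_all
        from schwartz_zero_if_two_equal_larger_dilations[OF \<phi> rel'(2) this(1) cJ[OF h(1)]
            cJ[OF j(1)] pos[OF h(1)] this(2,3) 2] show False
          using nz by contradiction
      qed
    qed
  qed
qed

end
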